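(* Let $n\ge 3$ be an integer. Then: \begin{itemize} \item $C_n$ is $3,2$-perfect. \item $C_n$ is $3,3$-perfect if and only if $n<7$ or ($n\ge 7$ and $2\mid n$). \item $C_n$ is $3,4$-perfect if and only if $n\ne 7$. \item $C_n$ is $3,5$-perfect if and only if ($n<10$ and $n\ne 7$) or ($n\ge 10$ and $3\mid n$). \item $C_n$ is $3,6$-perfect if and only if $n\notin\{7,10,11,13,17\}$. \item $C_n$ is $3,7$-perfect if and only if ($n<14$ and $n\notin\{7,10,11,13\}$) or ($n\ge 14$ and $4\mid n$). \item $C_n$ is $3,8$-perfect if and only if $n\notin\{7,10,11,13,14,15,16,17,21,22,26,31\}$. \item $C_n$ is $3,9$-perfect if and only if ($n<18$ and $n\notin\{7,10,11,13,14,15,16,17\}$) or ($n\ge 18$ and $5\mid n$). \end{itemize}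
   Context: $C_n$ is the cycle graph on $n$ vertices. All graphs are simple and undirected with nonempty vertex set. A shortest path in a graph $G$ is a path between some vertices $u,v$ whose length (number of edges) equals the graph distance between $u$ and $v$. A set $S\subseteq V(G)$ is $k,d$-independent in $G$ if every shortest path in $G$ of length at most $d$ contains fewer than $k$ vertices of $S$. The $k,d$-chromatic number $\chi^k_d(G)$ is the least positive integer $c$ such that some coloring $V(G)\to\{1,\dots,c\}$ has all color classes $k,d$-independent. A set $S\subseteq V(G)$ is a $k,d$-clique in $G$ if every $k$-element subset of $S$ is contained in some shortest path of $G$ of length at most $d$ (sets with fewer than $k$ elements are vacuously $k,d$-cliques); $\omega^k_d(G)$ is the supremum of the sizes of $k,d$-cliques in $G$. For $2\le k\le d+1$, $G$ is $k,d$-perfect if $\chi^k_d(H)=\left\lceil\frac{\omega^k_d(H)}{k-1}\right\rceil$ for every induced subgraph $H$ of $G$ (shortest paths being computed in $H$). *)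

theory Defs
  imports "Graph_Theory.Graph_Theory" "HOL-Library.Extended_Nat"
begin

(* A simple undirected graph is represented as a symmetric digraph without loops and parallel
   arcs, in the finite case an instance of the locale graph. Each path then occurs in both
   orientations, which is immaterial below. *)

definition cycle_graph :: "nat \<Rightarrow> (nat, nat \<times> nat) pre_digraph" where
  "cycle_graph n = with_proj
     \<lparr> pverts = {0..<n},
       parcs = {(u, v). u < n \<and> v < n \<and> (v = (u + 1) mod n \<or> u = (v + 1) mod n)} \<rparr>"

lemma graph_cycle_graph:
  assumes "n \<ge> 3"
  shows "graph (cycle_graph n)"
proof -
  let ?C = "\<lparr> pverts = {0..<n},
       parcs = {(u, v). u < n \<and> v < n \<and> (v = (u + 1) mod n \<or> u = (v + 1) mod n)} \<rparr>"
  have no_loop: False if "u < n" and "Suc u mod n = u" for u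
    using that assms by (cases "Suc u = n") auto
  have "parcs ?C \<subseteq> {0..<n} \<times> {0..<n}"
    by auto
  then have "finite (parcs ?C)"
    by (rule finite_subset) simp
  then have "pair_graph ?C"
    by unfold_locales (auto simp: symmetric_def sym_def dest: no_loop no_loop[OF _ sym])
  then interpret pair_graph ?C .
  show ?thesis
    unfolding cycle_graph_def by (rule graph_axioms)
qed

(* With all arcs of cost 1, the constant \<mu> is the graph distance (infinite if v is not
   reachable from u). The path is given by its list p of arcs, so its length is length p, and the
   one-vertex path at u is the empty list. *)
definition shortest_path :: "('a, 'b) pre_digraph \<Rightarrow> 'a \<Rightarrow> 'b awalk \<Rightarrow> 'a \<Rightarrow> bool" where
  "shortest_path G u p v \<longleftrightarrow>
     pre_digraph.apath G u p v \<and> ereal (real (length p)) = wf_digraph.\<mu> G (\<lambda>_. 1) u v"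

definition kd_independent :: "nat \<Rightarrow> nat \<Rightarrow> ('a, 'b) pre_digraph \<Rightarrow> 'a set \<Rightarrow> bool" where
  "kd_independent k d G S \<longleftrightarrow> S \<subseteq> verts G \<and>
     (\<forall>u p v. shortest_path G u p v \<and> length p \<le> d \<longrightarrow>
        card (S \<inter> set (pre_digraph.awalk_verts G u p)) < k)"

(* The value is \<infinity> if no finite number of colours suffices. *)
definition kd_chromatic_number :: "nat \<Rightarrow> nat \<Rightarrow> ('a, 'b) pre_digraph \<Rightarrow> enat" where
  "kd_chromatic_number k d G = Inf {enat c | c. c > 0 \<and>
     (\<exists>f. f ` verts G \<subseteq> {1..c} \<and> (\<forall>i\<in>{1..c}. kd_independent k d G {x \<in> verts G. f x = i}))}"

definition kd_clique :: "nat \<Rightarrow> nat \<Rightarrow> ('a, 'b) pre_digraph \<Rightarrow> 'a set \<Rightarrow> bool" where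
  "kd_clique k d G S \<longleftrightarrow> S \<subseteq> verts G \<and>
     (\<forall>T. T \<subseteq> S \<and> finite T \<and> card T = k \<longrightarrow>
        (\<exists>u p v. shortest_path G u p v \<and> length p \<le> d \<and>
           T \<subseteq> set (pre_digraph.awalk_verts G u p)))"

definition kd_clique_number :: "nat \<Rightarrow> nat \<Rightarrow> ('a, 'b) pre_digraph \<Rightarrow> enat" where
  "kd_clique_number k d G =
     (SUP S\<in>{S. kd_clique k d G S}. if finite S then enat (card S) else \<infinity>)"

definition ceil_divide_enat :: "enat \<Rightarrow> nat \<Rightarrow> enat" where
  "ceil_divide_enat x m =
     (case x of enat a \<Rightarrow> enat (nat \<lceil>real a / real m\<rceil>) | \<infinity> \<Rightarrow> \<infinity>)"

(* Meaningful for 2 \<le> k \<le> d + 1. Graphs have a nonempty vertex set, so the empty induced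
   subgraph is excluded. *)
definition kd_perfect :: "nat \<Rightarrow> nat \<Rightarrow> ('a, 'b) pre_digraph \<Rightarrow> bool" where
  "kd_perfect k d G \<longleftrightarrow>
     (\<forall>H. induced_subgraph H G \<and> verts H \<noteq> {} \<longrightarrow>
        kd_chromatic_number k d H = ceil_divide_enat (kd_clique_number k d H) (k - 1))"

end

theory Submission
  imports Defs
begin

text \<open>Put \<open>D = min d (n div 2)\<close>, the length of a longest shortest path of length at most \<open>d\<close>
  in \<open>C\<^sub>n\<close>. Such a path is a clique on \<open>D + 1\<close> vertices, and no clique has more than
  \<open>max 4 (D + 1)\<close>, so perfection asks for a colouring with \<open>D div 2 + 1\<close> colours (if
  \<open>D \<ge> 2\<close>). Each of the \<open>n\<close> windows of \<open>D + 1\<close> consecutive vertices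
  contains at most two vertices of a colour class; counting incidences, a class has
  at most \<open>q = 2 * n div (D + 1)\<close> vertices. Conversely, if \<open>n \<le> (D div 2 + 1) * q\<close>, then
  \<open>x \<mapsto> (x * q mod n) div q\<close> is such a colouring. A proper induced subgraph is a union of
  paths, laid out on a line, and is coloured by position modulo the number of colours. Hence
  \<open>C\<^sub>n\<close> is \<open>3,d\<close>-perfect if and only if \<open>n \<le> (D div 2 + 1) * q\<close>.\<close>

section \<open>Shortest paths, cliques and colourings in arbitrary graphs\<close>

text \<open>Replaces the infimum of extended real costs by a comparison of walk lengths:
  \<open>p\<close> is itself a walk, so the infimum is at most \<open>length p\<close>, and equality
  only says that \<open>length p\<close> is a lower bound.\<close>

lemma shortest_path_iff:
  assumes "wf_digraph G"
  shows "shortest_path G u p v \<longleftrightarrow>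
    pre_digraph.apath G u p v \<and> (\<forall>q. pre_digraph.awalk G u q v \<longrightarrow> length p \<le> length q)"
proof -
  interpret wf_digraph G by fact
  have cost: "awalk_cost (\<lambda>_. 1) q = real (length q)" for q :: "'b list"
    by (induct q) simp_all
  have "ereal (real (length p)) = \<mu> (\<lambda>_. 1) u v \<longleftrightarrow>
      (\<forall>q. awalk u q v \<longrightarrow> length p \<le> length q)" if "awalk u p v"
  proof -
    have "ereal (real (length p)) = \<mu> (\<lambda>_. 1) u v \<longleftrightarrow> ereal (real (length p)) \<le> \<mu> (\<lambda>_. 1) u v"
      using min_cost_le_walk_cost[OF that, of "\<lambda>_. 1"] by (auto simp: cost intro: antisym)
    also have "\<dots> \<longleftrightarrow> (\<forall>q. awalk u q v \<longrightarrow> length p \<le> length q)"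
      unfolding \<mu>_def by (auto simp: le_INF_iff cost)
    finally show ?thesis .
  qed
  then show ?thesis
    unfolding shortest_path_def apath_def by blast
qed

lemma card_le_mult_classes:
  assumes "finite S" "f ` S \<subseteq> {1..c}" "\<And>i. i \<in> {1..c} \<Longrightarrow> card {x \<in> S. f x = i} \<le> m"
  shows "card S \<le> c * m"
proof -
  have "(\<Union>i\<in>{1..c}. {x \<in> S. f x = i}) = S"
    using assms(2) by auto
  then have "card S \<le> (\<Sum>i\<in>{1..c}. card {x \<in> S. f x = i})"
    using card_UN_le[of "{1..c}" "\<lambda>i. {x \<in> S. f x = i}"] by simp
  also have "\<dots> \<le> (\<Sum>i\<in>{1..c}. m)"
    using assms(3) by (intro sum_mono)
  finally show ?thesis by simp
qed

lemma card_clique_Int_independent: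
  assumes "kd_clique k d G S" "kd_independent k d G I" "finite S" "k > 0"
  shows "card (S \<inter> I) \<le> k - 1"
proof (rule ccontr)
  assume "\<not> ?thesis"
  then have "k \<le> card (S \<inter> I)" using \<open>k > 0\<close> by simp
  then obtain T where T: "T \<subseteq> S \<inter> I" "card T = k" "finite T"
    by (rule obtain_subset_with_card_n)
  have "T \<subseteq> S" using T(1) by simp
  with T obtain u p v where "shortest_path G u p v" "length p \<le> d"
    and sub: "T \<subseteq> set (pre_digraph.awalk_verts G u p)"
    using assms(1) unfolding kd_clique_def by blast
  then have "card (I \<inter> set (pre_digraph.awalk_verts G u p)) < k"
    using assms(2) unfolding kd_independent_def by blast
  moreover have "card T \<le> card (I \<inter> set (pre_digraph.awalk_verts G u p))"
    using T sub by (intro card_mono) auto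
  ultimately show False using T by simp
qed

text \<open>Used in both directions: a colouring bounds every clique from above, and a clique bounds
  the number of colours from below.\<close>

lemma card_clique_le_colours:
  assumes "kd_clique k d G S" "finite S" "k > 0"
    and "f ` verts G \<subseteq> {1..c}"
    and "\<forall>i\<in>{1..c}. kd_independent k d G {x \<in> verts G. f x = i}"
  shows "card S \<le> c * (k - 1)"
proof (rule card_le_mult_classes[OF \<open>finite S\<close>])
  have sub: "S \<subseteq> verts G" using assms(1) by (simp add: kd_clique_def)
  then show "f ` S \<subseteq> {1..c}" using assms(4) by auto
  fix i assume "i \<in> {1..c}"
  then have "card (S \<inter> {x \<in> verts G. f x = i}) \<le> k - 1"
    using assms by (intro card_clique_Int_independent) auto
  moreover have "S \<inter> {x \<in> verts G. f x = i} = {x \<in> S. f x = i}"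
    using sub by auto
  ultimately show "card {x \<in> S. f x = i} \<le> k - 1" by simp
qed

text \<open>The colouring bounds the clique number by \<open>2 * c\<close> and \<open>S\<close>
  shows that it is at least \<open>2 * c - 1\<close>, so the ceiling is \<open>c\<close>. Fewer
  colours are impossible, because \<open>c'\<close> colours cover at most \<open>2 * c'\<close>
  vertices of \<open>S\<close>.\<close>

lemma chromatic_eq_ceil_clique:
  assumes fin: "finite (verts G)" and "c > 0"
    and f: "f ` verts G \<subseteq> {1..c}" "\<forall>i\<in>{1..c}. kd_independent 3 d G {x \<in> verts G. f x = i}"
    and S: "kd_clique 3 d G S" "2 * c \<le> card S + 1"
  shows "kd_chromatic_number 3 d G = ceil_divide_enat (kd_clique_number 3 d G) 2"
proof -
  have finite_clique: "finite T" if "kd_clique 3 d G T" for T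
    using that fin finite_subset unfolding kd_clique_def by blast
  have "kd_clique_number 3 d G \<le> enat (2 * c)"
    unfolding kd_clique_number_def
  proof (rule SUP_least)
    fix T assume "T \<in> {S. kd_clique 3 d G S}"
    then show "(if finite T then enat (card T) else \<infinity>) \<le> enat (2 * c)"
      using card_clique_le_colours[of 3 d G T f c] f finite_clique by auto
  qed
  then obtain a where a: "kd_clique_number 3 d G = enat a" "a \<le> 2 * c"
    by (cases "kd_clique_number 3 d G") auto
  have "enat (card S) \<le> kd_clique_number 3 d G"
    unfolding kd_clique_number_def using S finite_clique
    by (intro SUP_upper2[of S]) auto
  then have "2 * c \<le> a + 1" using a S by simp
  then have "ceil_divide_enat (kd_clique_number 3 d G) 2 = enat c"
    unfolding a ceil_divide_enat_def using a(2) by simp linarith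
  moreover have "kd_chromatic_number 3 d G = enat c"
    unfolding kd_chromatic_number_def
  proof (rule antisym)
    show "Inf {enat c |c. 0 < c \<and> (\<exists>f. f ` verts G \<subseteq> {1..c} \<and>
        (\<forall>i\<in>{1..c}. kd_independent 3 d G {x \<in> verts G. f x = i}))} \<le> enat c"
      using f \<open>c > 0\<close> by (intro Inf_lower) blast
    show "enat c \<le> Inf {enat c |c. 0 < c \<and> (\<exists>f. f ` verts G \<subseteq> {1..c} \<and>
        (\<forall>i\<in>{1..c}. kd_independent 3 d G {x \<in> verts G. f x = i}))}"
    proof (rule Inf_greatest, clarify)
      fix c' :: nat and f'
      assume "f' ` verts G \<subseteq> {1..c'}"
        and "\<forall>i\<in>{1..c'}. kd_independent 3 d G {x \<in> verts G. f' x = i}"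
      then have "card S \<le> c' * 2"
        using card_clique_le_colours[of 3 d G S f' c'] S finite_clique by auto
      then show "enat c \<le> enat c'" using S by simp
    qed
  qed
  ultimately show ?thesis by simp
qed

text \<open>Recovers an actual colouring from the equation: a bounded clique number makes the
  chromatic number finite, hence attained.\<close>

lemma colouring_of_chromatic_eq:
  assumes eq: "kd_chromatic_number 3 d G = ceil_divide_enat (kd_clique_number 3 d G) 2"
    and le: "kd_clique_number 3 d G \<le> enat (2 * c)"
  obtains c' f where "c' \<le> c" "f ` verts G \<subseteq> {1..c'}"
    "\<forall>i\<in>{1..c'}. kd_independent 3 d G {x \<in> verts G. f x = i}"
proof -
  let ?A = "{enat c |c. c > 0 \<and> (\<exists>f. f ` verts G \<subseteq> {1..c} \<and>
    (\<forall>i\<in>{1..c}. kd_independent 3 d G {x \<in> verts G. f x = i}))}"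
  obtain a where a: "kd_clique_number 3 d G = enat a" "a \<le> 2 * c"
    using le by (cases "kd_clique_number 3 d G") auto
  have "nat \<lceil>real a / real 2\<rceil> \<le> c" using a(2) by simp
  then have *: "Inf ?A \<le> enat c"
    using eq unfolding a ceil_divide_enat_def kd_chromatic_number_def by simp
  \<comment> \<open>The infimum of the empty set would be infinite.\<close>
  then have "?A \<noteq> {}"
    by (metis (no_types, lifting) Inf_enat_def enat_ord_simps(5) infinity_ileE)
  then have "Inf ?A \<in> ?A"
    unfolding Inf_enat_def by (metis (no_types, lifting) LeastI ex_in_conv)
  with * show ?thesis using that by auto
qed

text \<open>The length of this path stands in for \<open>D\<close> in graphs whose distances are not
  computed. The empty path at any vertex and the bound \<open>d\<close> ensure that the maximum
  exists.\<close>

lemma ex_longest_shortest_path: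
  assumes "wf_digraph G" "verts G \<noteq> {}"
  obtains u p v where "shortest_path G u p v" "length p \<le> d"
    "\<And>u' q v'. shortest_path G u' q v' \<Longrightarrow> length q \<le> d \<Longrightarrow> length q \<le> length p"
proof -
  interpret wf_digraph G by fact
  let ?P = "\<lambda>l. \<exists>u p v. shortest_path G u p v \<and> length p \<le> d \<and> l = length p"
  obtain x where "x \<in> verts G" using assms(2) by blast
  then have "shortest_path G x [] x"
    by (simp add: shortest_path_iff[OF assms(1)] apath_Nil_iff)
  then have ex: "?P 0" by force
  then have "?P (Greatest ?P)" by (rule GreatestI_nat[where b = d]) auto
  moreover have "l \<le> Greatest ?P" if "?P l" for l
    using that by (rule Greatest_le_nat[where b = d]) auto
  ultimately show ?thesis using that by metis
qed

lemma kd_clique_shortest_path: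
  assumes "wf_digraph G" "shortest_path G u p v" "length p \<le> d"
  shows "kd_clique k d G (set (pre_digraph.awalk_verts G u p))"
    and "card (set (pre_digraph.awalk_verts G u p)) = Suc (length p)"
proof -
  interpret wf_digraph G by fact
  have *: "awalk u p v" "distinct (awalk_verts u p)"
    using assms by (auto simp: shortest_path_iff apath_def)
  then have "set (awalk_verts u p) \<subseteq> verts G" by blast
  then show "kd_clique k d G (set (awalk_verts u p))"
    using assms unfolding kd_clique_def by blast
  show "card (set (awalk_verts u p)) = Suc (length p)"
    using * by (simp add: distinct_card length_awalk_verts)
qed

section \<open>Lifting walks and colourings to the integers\<close>

text \<open>\<open>R x i\<close> reads: the integer \<open>i\<close> lies over the vertex
  \<open>x\<close>. Neighbours lie over neighbouring integers, so a walk unrolls, starting from its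
  end, to integers that change by one per arc and stay in an interval of its length.\<close>

lemma awalk_lift_interval:
  fixes R :: "'a \<Rightarrow> int \<Rightarrow> bool"
  assumes wf: "wf_digraph G" and walk: "pre_digraph.awalk G u p v"
    and ex: "\<And>x. x \<in> verts G \<Longrightarrow> \<exists>i. R x i"
    and step: "\<And>e i. e \<in> arcs G \<Longrightarrow> R (head G e) i \<Longrightarrow> R (tail G e) (i - 1) \<or> R (tail G e) (i + 1)"
  shows "\<exists>a. \<forall>x\<in>set (pre_digraph.awalk_verts G u p). \<exists>i\<in>{a..a + int (length p)}. R x i"
proof -
  interpret wf_digraph G by fact
  show ?thesis using walk
  proof (induct p arbitrary: u)
    case Nil
    then show ?case using ex[of u] by (auto simp: awalk_Nil_iff)
  next
    case (Cons e p)
    then have e: "e \<in> arcs G" and w: "awalk (head G e) p v" by (auto simp: awalk_Cons_iff)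
    then obtain a where a: "\<forall>x\<in>set (awalk_verts (head G e) p). \<exists>i\<in>{a..a + int (length p)}. R x i"
      using Cons(1) by blast
    moreover have "head G e \<in> set (awalk_verts (head G e) p)"
      using w by (rule hd_in_awalk_verts)
    ultimately obtain i where i: "i \<in> {a..a + int (length p)}" "R (head G e) i" by blast
    from step[OF e this(2)] show ?case
    proof
      \<comment> \<open>The interval grows by one for the new arc, to the left in this case and to
        the right in the other.\<close>
      assume "R (tail G e) (i - 1)"
      then show ?thesis using i(1) a by (intro exI[of _ "a - 1"]) fastforce
    next
      assume "R (tail G e) (i + 1)"
      then show ?thesis using i(1) a by (intro exI[of _ a]) fastforce
    qed
  qed
qed

text \<open>Two equal values at distinct arguments differ by at least one full turn modulo \<open>n\<close>, up to
  an error below \<open>q\<close> that telescopes over consecutive arguments.\<close>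
lemma scaled_residue_gap:
  fixes i j k n q w :: int
  assumes "q > 0" "n > 0" "q * w \<le> 2 * n" "i < j" "j < k"
    and "(i * q) mod n div q = (j * q) mod n div q" "(j * q) mod n div q = (k * q) mod n div q"
  shows "k - i \<ge> w"
proof -
  define t where "t = (i * q) mod n div q"
  have bounds: "t * q \<le> (x * q) mod n \<and> (x * q) mod n < t * q + q"
    if "(x * q) mod n div q = t" for x
    using that \<open>q > 0\<close>
    by (metis add.commute div_mult_mod_eq le_add_same_cancel1 add_strict_left_mono
        pos_mod_bound pos_mod_sign)
  have bi: "t * q \<le> (i * q) mod n" "(i * q) mod n < t * q + q"
    and bj: "t * q \<le> (j * q) mod n" "(j * q) mod n < t * q + q"
    and bk: "t * q \<le> (k * q) mod n" "(k * q) mod n < t * q + q"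
    using bounds[of i] bounds[of j] bounds[of k] assms(6,7) by (auto simp: t_def)
  have dec: "x * q = n * ((x * q) div n) + (x * q) mod n" for x by simp
  \<comment> \<open>Without a rise of the quotient, the distinct multiples \<open>x * q\<close> and
    \<open>y * q\<close> would differ by no more than their residues do, hence by less than
    \<open>q\<close>.\<close>
  have quot: "(x * q) div n + 1 \<le> (y * q) div n"
    if "x < y" "t * q \<le> (x * q) mod n" "(y * q) mod n < t * q + q" for x y
  proof (rule ccontr)
    assume "\<not> ?thesis"
    then have "n * ((y * q) div n) \<le> n * ((x * q) div n)"
      using \<open>n > 0\<close> by (intro mult_left_mono) auto
    then have "y * q - x * q < q"
      using dec[of x] dec[of y] that by linarith
    moreover have "(x + 1) * q \<le> y * q"
      using that \<open>q > 0\<close> by (intro mult_right_mono) auto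
    ultimately show False by (simp add: algebra_simps)
  qed
  have "(i * q) div n + 2 \<le> (k * q) div n"
    using quot[of i j] quot[of j k] bi bj bk assms by linarith
  then have "n * ((i * q) div n + 2) \<le> n * ((k * q) div n)"
    using \<open>n > 0\<close> by (intro mult_left_mono) auto
  then have "n * ((i * q) div n) + 2 * n \<le> n * ((k * q) div n)"
    by (simp add: algebra_simps)
  then have "2 * n < k * q - i * q + q"
    using dec[of i] dec[of k] bi bk by linarith
  then have "q * w < q * (k - i + 1)"
    using assms(3) by (simp add: algebra_simps)
  then show ?thesis using \<open>q > 0\<close> by simp
qed

text \<open>Three vertices of one colour on a shortest path would lie under three distinct integers
  with equal \<open>g\<close> in an interval of length at most \<open>l\<close>, which
  \<open>gap\<close> excludes.\<close>

lemma lifted_colouring_independent: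
  fixes R :: "'a \<Rightarrow> int \<Rightarrow> bool"
  assumes wf: "wf_digraph G"
    and ex: "\<And>x. x \<in> verts G \<Longrightarrow> \<exists>i. R x i"
    and step: "\<And>e i. e \<in> arcs G \<Longrightarrow> R (head G e) i \<Longrightarrow> R (tail G e) (i - 1) \<or> R (tail G e) (i + 1)"
    and inj: "\<And>x y i. R x i \<Longrightarrow> R y i \<Longrightarrow> x = y"
    and col: "\<And>x i. R x i \<Longrightarrow> f x = g i"
    and gap: "\<And>i j k. i < j \<Longrightarrow> j < k \<Longrightarrow> g i = g j \<Longrightarrow> g j = g k \<Longrightarrow> k - i > int l"
    and len: "\<And>u p v. shortest_path G u p v \<Longrightarrow> length p \<le> d \<Longrightarrow> length p \<le> l"
  shows "kd_independent 3 d G {x \<in> verts G. f x = c}"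
  unfolding kd_independent_def
proof (intro conjI allI impI)
  fix u p v
  assume p: "shortest_path G u p v \<and> length p \<le> d"
  let ?W = "set (pre_digraph.awalk_verts G u p)"
  have "pre_digraph.awalk G u p v"
    using p by (simp add: shortest_path_iff[OF wf] pre_digraph.apath_def)
  from awalk_lift_interval[where R = R, OF wf this ex step]
  obtain a where a: "\<forall>x\<in>?W. \<exists>i\<in>{a..a + int (length p)}. R x i" by blast
  have pl: "length p \<le> l" using len p by blast
  show "card ({x \<in> verts G. f x = c} \<inter> ?W) < 3"
  proof (rule ccontr)
    assume "\<not> ?thesis"
    then have "3 \<le> card ({x \<in> verts G. f x = c} \<inter> ?W)" by simp
    then obtain T where "T \<subseteq> {x \<in> verts G. f x = c} \<inter> ?W" "card T = 3"
      by (rule obtain_subset_with_card_n)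
    then obtain x y z where xyz: "x \<noteq> y" "y \<noteq> z" "x \<noteq> z" "{x, y, z} \<subseteq> {x \<in> verts G. f x = c} \<inter> ?W"
      by (auto simp: card_3_iff)
    obtain i where i: "R x i" "i \<in> {a..a + int (length p)}" using a xyz(4) by blast
    obtain j where j: "R y j" "j \<in> {a..a + int (length p)}" using a xyz(4) by blast
    obtain k where k: "R z k" "k \<in> {a..a + int (length p)}" using a xyz(4) by blast
    note ijk = i(1) j(1) k(1) i(2) j(2) k(2)
    have "i \<noteq> j \<and> j \<noteq> k \<and> i \<noteq> k" using xyz(1-3) inj ijk(1-3) by metis
    moreover have "g i = c" "g j = c" "g k = c" using xyz(4) col[OF ijk(1)] col[OF ijk(2)] col[OF ijk(3)] by auto
    \<comment> \<open>The order of the three lifts is unknown, so \<open>gap\<close> is supplied for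
      all six orders.\<close>
    ultimately show False
      using gap[of i j k] gap[of i k j] gap[of j i k] gap[of j k i] gap[of k i j] gap[of k j i]
        ijk(4-6) pl by (auto simp: neq_iff)
  qed
qed auto

text \<open>One criterion for the cycle and for its proper subgraphs. With
  \<open>L = length p\<close> and \<open>c = L div 2 + 1\<close>, the bound
  \<open>m \<le> c * q\<close> keeps the block numbers below \<open>c\<close>, the bound
  \<open>q * (L + 1) \<le> 2 * m\<close> allows \<open>w = L + 1\<close> in
  \<open>scaled_residue_gap\<close>, and the \<open>L + 1\<close> vertices of \<open>p\<close> form
  a clique with \<open>2 * c \<le> L + 2\<close>. By \<open>col\<close> the colour does not depend
  on the chosen lift.\<close>

lemma chromatic_eq_ceil_clique_of_lift:
  fixes R :: "'a \<Rightarrow> int \<Rightarrow> bool"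
  assumes wf: "wf_digraph G" and fin: "finite (verts G)"
    and ex: "\<And>x. x \<in> verts G \<Longrightarrow> \<exists>i. R x i"
    and step: "\<And>e i. e \<in> arcs G \<Longrightarrow> R (head G e) i \<Longrightarrow> R (tail G e) (i - 1) \<or> R (tail G e) (i + 1)"
    and inj: "\<And>x y i. R x i \<Longrightarrow> R y i \<Longrightarrow> x = y"
    and longest: "shortest_path G u p v" "length p \<le> d"
      "\<And>u' p' v'. shortest_path G u' p' v' \<Longrightarrow> length p' \<le> d \<Longrightarrow> length p' \<le> length p"
    and col: "\<And>x i. R x i \<Longrightarrow> f x = (i * int q) mod int m div int q"
    and q: "q > 0" "m > 0" "q * (length p + 1) \<le> 2 * m" "m \<le> (length p div 2 + 1) * q"
  shows "kd_chromatic_number 3 d G = ceil_divide_enat (kd_clique_number 3 d G) 2"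
proof (rule chromatic_eq_ceil_clique[OF fin])
  \<comment> \<open>\<open>?h\<close> moves the block numbers \<open>0, ..., c - 1\<close> to the
    colours \<open>1, ..., c\<close>.\<close>
  let ?c = "length p div 2 + 1" and ?h = "\<lambda>t :: int. nat t + 1"
  let ?g = "\<lambda>i. ?h ((i * int q) mod int m div int q)"
  show "(\<lambda>x. ?h (f x)) ` verts G \<subseteq> {1..?c}"
  proof clarify
    fix x assume "x \<in> verts G"
    then obtain i where "R x i" using ex by blast
    then have "f x = (i * int q) mod int m div int q" by (rule col)
    moreover have "(i * int q) mod int m < int ?c * int q"
    proof -
      have "(i * int q) mod int m < int m" using q by simp
      also have "\<dots> \<le> int ?c * int q" using q(4) by (metis of_nat_le_iff of_nat_mult)
      finally show ?thesis .
    qed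
    moreover have "(i * int q) mod int m div int q * int q \<le> (i * int q) mod int m"
      using q(1) div_mult_mod_eq[of "(i * int q) mod int m" "int q"]
        pos_mod_sign[of "int q" "(i * int q) mod int m"] by linarith
    ultimately have "f x < int ?c"
      using q(1) by (metis le_less_trans mult_less_cancel_right_pos of_nat_0_less_iff)
    then show "?h (f x) \<in> {1..?c}" by simp
  qed
  show "\<forall>i\<in>{1..?c}. kd_independent 3 d G {x \<in> verts G. ?h (f x) = i}"
  proof
    fix c
    show "kd_independent 3 d G {x \<in> verts G. ?h (f x) = c}"
    proof (rule lifted_colouring_independent[where R = R, OF wf ex step inj])
      show "?h (f x) = ?g i" if "R x i" for x i using col[OF that] by simp
      show "k - i > int (length p)" if "i < j" "j < k" "?g i = ?g j" "?g j = ?g k" for i j k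
      proof -
        \<comment> \<open>\<open>nat\<close> sends all negative integers to 0, so equal values of
          \<open>?g\<close> give equal block numbers only if these are nonnegative.\<close>
        have nonneg: "(x * int q) mod int m div int q \<ge> 0" for x
          using q by (simp add: pos_imp_zdiv_nonneg_iff)
        have "int q * (int (length p) + 1) \<le> 2 * int m"
          using q(3) by (metis (mono_tags) of_nat_1 of_nat_add of_nat_le_iff of_nat_mult of_nat_numeral)
        then have "int (length p) + 1 \<le> k - i"
          using scaled_residue_gap[of "int q" "int m" "int (length p) + 1" i j k] that q
            nonneg[of i] nonneg[of j] nonneg[of k] by simp
        then show ?thesis by simp
      qed
    qed (use longest in auto)
  qed
  show "kd_clique 3 d G (set (pre_digraph.awalk_verts G u p))"
    and "2 * ?c \<le> card (set (pre_digraph.awalk_verts G u p)) + 1"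
    using kd_clique_shortest_path[OF wf longest(1,2)] by auto
qed simp

section \<open>Walks and distances in the cycle\<close>

lemma cycle_graph_simps:
  "verts (cycle_graph n) = {0..<n}"
  "arcs (cycle_graph n) =
    {(u, v). u < n \<and> v < n \<and> (v = (u + 1) mod n \<or> u = (v + 1) mod n)}"
  "tail (cycle_graph n) = fst" "head (cycle_graph n) = snd"
  by (simp_all add: cycle_graph_def)

lemma wf_digraph_cycle_graph: "n \<ge> 3 \<Longrightarrow> wf_digraph (cycle_graph n)"
  using graph_cycle_graph[of n] by (simp add: graph_def digraph_def fin_digraph_def)

text \<open>Arcs are pairs of end vertices here, so a vertex sequence \<open>h\<close> determines
  its arcs; walks in the cycle can then be given by residue formulas.\<close>

lemma awalk_map_upt:
  fixes h :: "nat \<Rightarrow> 'a" and G :: "('a, 'a \<times> 'a) pre_digraph"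
  assumes "wf_digraph G" "tail G = fst" "head G = snd" "h 0 \<in> verts G"
    and "\<And>i. i < m \<Longrightarrow> (h i, h (Suc i)) \<in> arcs G"
  shows "pre_digraph.awalk G (h 0) (map (\<lambda>i. (h i, h (Suc i))) [0..<m]) (h m)"
    and "pre_digraph.awalk_verts G (h 0) (map (\<lambda>i. (h i, h (Suc i))) [0..<m]) = map h [0..<Suc m]"
proof -
  interpret wf_digraph G by fact
  have verts: "awalk_verts (h 0) (map (\<lambda>i. (h i, h (Suc i))) [0..<l]) = map h [0..<Suc l]" for l
    by (cases l) (auto simp: awalk_verts_conv assms(2,3) last_map)
  then show "awalk_verts (h 0) (map (\<lambda>i. (h i, h (Suc i))) [0..<m]) = map h [0..<Suc m]" .
  show "awalk (h 0) (map (\<lambda>i. (h i, h (Suc i))) [0..<m]) (h m)" using assms(5)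
  proof (induct m)
    case 0
    then show ?case using assms(4) by (simp add: awalk_Nil_iff)
  next
    case (Suc m)
    then have arc: "(h m, h (Suc m)) \<in> arcs G"
      and w: "awalk (h 0) (map (\<lambda>i. (h i, h (Suc i))) [0..<m]) (h m)" by simp_all
    have "awalk (h m) [(h m, h (Suc m))] (h (Suc m))"
      using arc_implies_awalk[OF arc] assms(2,3) by simp
    from awalk_appendI[OF w this] show ?case by simp
  qed
qed

text \<open>Reduction modulo \<open>n\<close> wraps the integer line around the cycle; this is the
  \<open>step\<close> hypothesis of the lifting lemmas for it.\<close>

lemma cycle_graph_arc_lift:
  assumes "e \<in> arcs (cycle_graph n)" "int (head (cycle_graph n) e) = i mod int n"
  shows "int (tail (cycle_graph n) e) = (i - 1) mod int n \<or>
    int (tail (cycle_graph n) e) = (i + 1) mod int n"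
proof -
  obtain x y where e: "e = (x, y)" "x < n" "y < n" "y = (x + 1) mod n \<or> x = (y + 1) mod n"
    using assms(1) by (auto simp: cycle_graph_simps)
  have y: "int y = i mod int n" using assms(2) e(1) by (simp add: cycle_graph_simps)
  from e(4) have "int x = (i - 1) mod int n \<or> int x = (i + 1) mod int n"
  proof
    assume "y = (x + 1) mod n"
    then have "i mod int n = (int x + 1) mod int n" using y by (simp add: of_nat_mod add.commute)
    then have "(i - 1) mod int n = (int x + 1 - 1) mod int n" by (metis mod_diff_left_eq)
    then show ?thesis using e(2) by simp
  next
    assume "x = (y + 1) mod n"
    then have "int x = (i mod int n + 1) mod int n" using y by (simp add: of_nat_mod add.commute)
    then show ?thesis by (simp add: mod_add_left_eq)
  qed
  then show ?thesis using e(1) by (simp add: cycle_graph_simps)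
qed

lemma cycle_graph_awalk_window:
  assumes "n \<ge> 3" "pre_digraph.awalk (cycle_graph n) u p v"
  shows "\<exists>a. \<forall>x\<in>set (pre_digraph.awalk_verts (cycle_graph n) u p).
    \<exists>i\<in>{a..a + int (length p)}. int x = i mod int n"
proof (rule awalk_lift_interval[OF wf_digraph_cycle_graph assms(2)])
  show "\<exists>i. int x = i mod int n" if "x \<in> verts (cycle_graph n)" for x
    using that by (intro exI[of _ "int x"]) (simp add: cycle_graph_simps)
qed (use assms cycle_graph_arc_lift in auto)

lemma cycle_graph_awalk_steps:
  assumes "n \<ge> 3" "u < n" and v: "v = (u + k) mod n \<or> u = (v + k) mod n" "v < n"
  shows "\<exists>p. pre_digraph.awalk (cycle_graph n) u p v \<and> length p = k"
proof -
  have *: "\<exists>p. pre_digraph.awalk (cycle_graph n) (h 0) p (h k) \<and> length p = k"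
    if "\<And>i. h i < n" "\<And>i. h (Suc i) = (h i + 1) mod n \<or> h i = (h (Suc i) + 1) mod n" for h
    using awalk_map_upt(1)[OF wf_digraph_cycle_graph[OF \<open>n \<ge> 3\<close>], of h k] that
    by (intro exI[of _ "map (\<lambda>i. (h i, h (Suc i))) [0..<k]"]) (simp add: cycle_graph_simps)
  from v(1) show ?thesis
  proof
    assume "v = (u + k) mod n"
    then show ?thesis
      using *[of "\<lambda>i. (u + i) mod n"] assms by (simp add: mod_Suc_eq)
  next
    \<comment> \<open>Walking backwards: adding \<open>n - 1\<close> is a step by -1 modulo
      \<open>n\<close> that stays within the natural numbers.\<close>
    assume u: "u = (v + k) mod n"
    have "(u + (n - 1) * k) mod n = (v + k + (n - 1) * k) mod n"
      unfolding u by (rule mod_add_left_eq)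
    also have "v + k + (n - 1) * k = v + n * k"
      using assms by (cases n) auto
    finally have "(u + (n - 1) * k) mod n = v" using v by simp
    moreover have "(u + (n - 1) * i) mod n = ((u + (n - 1) * Suc i) mod n + 1) mod n" for i
    proof -
      have "u + (n - 1) * Suc i + 1 = u + (n - 1) * i + n" using assms by simp
      then show ?thesis by (metis mod_add_left_eq mod_add_self2)
    qed
    ultimately show ?thesis
      using *[of "\<lambda>i. (u + (n - 1) * i) mod n"] assms by simp
  qed
qed

text \<open>Of the two ways round between the end vertices, the shorter has at most
  \<open>n div 2\<close> edges.\<close>

lemma cycle_graph_shortest_path_length:
  assumes "n \<ge> 3" "shortest_path (cycle_graph n) u p v"
  shows "length p \<le> n div 2"
proof -
  interpret wf_digraph "cycle_graph n" using assms(1) by (rule wf_digraph_cycle_graph)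
  have short: "length p \<le> length q" if "awalk u q v" for q
    using that assms(2) by (simp add: shortest_path_iff[OF wf_digraph_axioms])
  have "awalk u p v"
    using assms(2) by (simp add: shortest_path_iff[OF wf_digraph_axioms] apath_def)
  then have uv: "u < n" "v < n"
    using awalk_hd_in_verts awalk_last_in_verts by (auto simp: cycle_graph_simps)
  have "\<exists>k \<le> n div 2. v = (u + k) mod n \<or> u = (v + k) mod n"
  proof -
    have *: "\<exists>k \<le> n div 2. y = (x + k) mod n \<or> x = (y + k) mod n" if "x \<le> y" "y < n" for x y
    proof (cases "y - x \<le> n div 2")
      case True
      then show ?thesis using that by (intro exI[of _ "y - x"]) simp
    next
      case False
      then show ?thesis using that by (intro exI[of _ "n - (y - x)"]) simp
    qed
    show ?thesis using *[of u v] *[of v u] uv by (meson linear)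
  qed
  then show ?thesis
    using cycle_graph_awalk_steps[OF assms(1) uv(1) _ uv(2)] short by (metis le_trans)
qed

text \<open>Walking \<open>l\<close> steps in one direction is shortest: a walk with fewer arcs
  would lift to an interval shorter than \<open>l\<close>, whereas lifts of its two ends differ by a
  number congruent to \<open>l\<close> modulo \<open>n\<close>, which has absolute value at least
  \<open>l\<close> because \<open>n - l \<ge> l\<close>.\<close>

lemma cycle_graph_shortest_path_window:
  assumes "n \<ge> 3" "l \<le> n div 2" "a < n"
  shows "\<exists>p. shortest_path (cycle_graph n) a p ((a + l) mod n) \<and> length p = l \<and>
    set (pre_digraph.awalk_verts (cycle_graph n) a p) = (\<lambda>i. (a + i) mod n) ` {0..l}"
proof -
  interpret wf_digraph "cycle_graph n" using assms(1) by (rule wf_digraph_cycle_graph)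
  let ?h = "\<lambda>i. (a + i) mod n"
  let ?p = "map (\<lambda>i. (?h i, ?h (Suc i))) [0..<l]"
  have h0: "?h 0 = a" using assms by simp
  have walk: "awalk a ?p (?h l)" and verts: "awalk_verts a ?p = map ?h [0..<Suc l]"
    using awalk_map_upt[OF wf_digraph_axioms, of ?h l] assms unfolding h0
    by (auto simp: cycle_graph_simps mod_Suc_eq)
  have "inj_on ?h {0..<Suc l}"
  proof (rule inj_onI)
    fix i j assume ij: "i \<in> {0..<Suc l}" "j \<in> {0..<Suc l}" "?h i = ?h j"
    moreover have "?h m = (if a + m < n then a + m else a + m - n)" if "m \<le> l" for m
      using that assms by (simp add: le_mod_geq)
    ultimately show "i = j" using assms by (auto split: if_splits)
  qed
  then have "distinct (awalk_verts a ?p)" unfolding verts by (simp add: distinct_map del: upt_Suc)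
  moreover have "l \<le> length q" if q: "awalk a q (?h l)" for q
  proof (rule ccontr)
    assume "\<not> ?thesis"
    obtain b where b: "\<forall>x\<in>set (awalk_verts a q). \<exists>i\<in>{b..b + int (length q)}. int x = i mod int n"
      using cycle_graph_awalk_window[OF assms(1) q] by blast
    have "a \<in> set (awalk_verts a q)" using q by (rule hd_in_awalk_verts)
    moreover have "?h l \<in> set (awalk_verts a q)"
      using q by (metis awalkE' awalk_verts_non_Nil last_in_set)
    ultimately obtain i j where ij: "i \<in> {b..b + int (length q)}" "int a = i mod int n"
        "j \<in> {b..b + int (length q)}" "int (?h l) = j mod int n"
      using b by meson
    have "(j - i) mod int n = (int (?h l) - int a) mod int n"
      using ij by (metis mod_diff_eq)
    also have "\<dots> = int l mod int n"
      by (simp add: of_nat_mod mod_diff_left_eq)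
    finally have "(j - i) mod int n = int l" using assms by simp
    \<comment> \<open>Both lifts lie in an interval shorter than \<open>n\<close>, so at most one
      \<open>n\<close> has to be added.\<close>
    moreover have "(j - i) mod int n = (if j - i \<ge> 0 then j - i else j - i + int n)"
    proof (cases "j - i \<ge> 0")
      case True
      then show ?thesis using ij \<open>\<not> l \<le> length q\<close> assms by simp
    next
      case False
      then have "(j - i + int n) mod int n = j - i + int n"
        using ij \<open>\<not> l \<le> length q\<close> assms by (intro mod_pos_pos_trivial) auto
      then show ?thesis using False by simp
    qed
    ultimately show False using ij \<open>\<not> l \<le> length q\<close> assms by (auto split: if_splits)
  qed
  ultimately have "shortest_path (cycle_graph n) a ?p (?h l)"
    using walk by (simp add: shortest_path_iff[OF wf_digraph_axioms] apath_def)
  moreover have "set (awalk_verts a ?p) = ?h ` {0..l}"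
    unfolding verts by (simp add: atLeast0AtMost lessThan_Suc_atMost flip: lessThan_atLeast0 del: upt_Suc)
  ultimately show ?thesis by (intro exI[of _ ?p]) simp
qed

section \<open>Counting in cyclic windows\<close>

text \<open>Double counting of the pairs of a start \<open>a\<close> and an offset \<open>i\<close>
  with \<open>(a + i) mod n\<close> in \<open>S\<close>: rotation by \<open>i\<close> is a
  bijection, so each offset occurs \<open>card S\<close> times, while each start occurs at most
  \<open>m\<close> times.\<close>

lemma card_le_windows_nat:
  fixes S :: "nat set"
  assumes "S \<subseteq> {0..<n}" "l < n"
    and window: "\<And>a. a < n \<Longrightarrow> card (S \<inter> (\<lambda>i. (a + i) mod n) ` {0..l}) \<le> m"
  shows "card S * (l + 1) \<le> m * n"
proof -
  have mod: "(a + i) mod n = (if a + i < n then a + i else a + i - n)" if "a < n" "i < n" for a i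
    using that by (simp add: le_mod_geq)
  have shift: "bij_betw (\<lambda>a. (a + i) mod n) {0..<n} {0..<n}" if "i < n" for i
  proof -
    have "inj_on (\<lambda>a. (a + i) mod n) {0..<n}"
      using that by (auto simp: inj_on_def mod split: if_splits)
    moreover have "(\<lambda>a. (a + i) mod n) ` {0..<n} \<subseteq> {0..<n}" using that by auto
    ultimately show ?thesis by (simp add: bij_betw_def endo_inj_surj)
  qed
  have "card S * (l + 1) = (\<Sum>i\<in>{0..l}. card S)" by simp
  also have "\<dots> = (\<Sum>i\<in>{0..l}. \<Sum>a\<in>{0..<n}. of_bool ((a + i) mod n \<in> S))"
  proof (rule sum.cong)
    fix i assume "i \<in> {0..l}"
    then have "(\<Sum>a\<in>{0..<n}. of_bool ((a + i) mod n \<in> S)) = (\<Sum>x\<in>{0..<n}. of_bool (x \<in> S) :: nat)"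
      using shift[of i] \<open>l < n\<close> by (intro sum.reindex_bij_betw) auto
    also have "\<dots> = card {x \<in> {0..<n}. x \<in> S}" by (simp add: of_bool_def flip: sum.inter_filter)
    also have "{x \<in> {0..<n}. x \<in> S} = S" using assms(1) by auto
    finally show "card S = (\<Sum>a\<in>{0..<n}. of_bool ((a + i) mod n \<in> S))" by simp
  qed simp
  also have "\<dots> = (\<Sum>a\<in>{0..<n}. \<Sum>i\<in>{0..l}. of_bool ((a + i) mod n \<in> S))" by (rule sum.swap)
  also have "\<dots> \<le> (\<Sum>a\<in>{0..<n}. m)"
  proof (rule sum_mono)
    fix a assume a: "a \<in> {0..<n}"
    let ?I = "{i \<in> {0..l}. (a + i) mod n \<in> S}"
    have "inj_on (\<lambda>i. (a + i) mod n) ?I"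
      using a \<open>l < n\<close> by (auto simp: inj_on_def mod split: if_splits)
    then have "card ?I = card ((\<lambda>i. (a + i) mod n) ` ?I)" by (simp add: card_image)
    also have "(\<lambda>i. (a + i) mod n) ` ?I = S \<inter> (\<lambda>i. (a + i) mod n) ` {0..l}" by auto
    also have "card \<dots> \<le> m" using window a by simp
    finally show "(\<Sum>i\<in>{0..l}. of_bool ((a + i) mod n \<in> S)) \<le> m"
      by (simp add: of_bool_def flip: sum.inter_filter)
  qed
  also have "\<dots> = m * n" by simp
  finally show ?thesis .
qed

text \<open>The alternatives in \<open>triple\<close> say that a window of \<open>D + 1\<close>
  consecutive vertices starting at \<open>x\<close>, \<open>y\<close> or \<open>z\<close>,
  respectively, contains all three. The 4 is genuine: for \<open>n = 4\<close> and
  \<open>D = 2\<close> all four vertices qualify.\<close>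

lemma card_pairwise_windows_le:
  fixes S :: "nat set"
  assumes "S \<subseteq> {0..<n}" "2 * D \<le> n"
    and triple: "\<And>x y z. \<lbrakk>x \<in> S; y \<in> S; z \<in> S; x < y; y < z\<rbrakk> \<Longrightarrow>
      z \<le> x + D \<or> x + n \<le> y + D \<or> y + n \<le> z + D"
  shows "card S \<le> max 4 (D + 1)"
proof (cases "S = {}")
  case False
  have fin: "finite S" using assms(1) finite_subset by blast
  define lo hi where "lo = Min S" and "hi = Max S"
  have lh: "lo \<in> S" "hi \<in> S" "\<And>y. y \<in> S \<Longrightarrow> lo \<le> y" "\<And>y. y \<in> S \<Longrightarrow> y \<le> hi"
    using fin False by (auto simp: lo_def hi_def)
  have ltn: "\<And>y. y \<in> S \<Longrightarrow> y < n" using assms(1) by auto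
  show ?thesis
  proof (cases "hi \<le> lo + D")
    case True
    then have "S \<subseteq> {lo..lo + D}" using lh by fastforce
    then have "card S \<le> card {lo..lo + D}" by (intro card_mono) auto
    then show ?thesis by simp
  next
    case far: False
    \<comment> \<open>\<open>A\<close> is what \<open>hi\<close> reaches across 0 within
      \<open>D\<close> steps, \<open>B\<close> is what reaches \<open>lo\<close> that way. The
      triple \<open>lo\<close>, \<open>y\<close>, \<open>hi\<close> puts each \<open>y\<close>
      strictly between into one of them.\<close>
    define A where "A = {y \<in> S. y + n \<le> hi + D}"
    define B where "B = {y \<in> S. lo + n \<le> y + D}"
    have S: "S \<subseteq> A \<union> B \<union> {lo, hi}"
    proof
      fix y assume "y \<in> S"
      then show "y \<in> A \<union> B \<union> {lo, hi}"
        using triple[of lo y hi] lh(1,2) lh(3)[of y] lh(4)[of y] far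
        by (auto simp: A_def B_def)
    qed
    show ?thesis
    proof (cases "lo + n \<le> hi + D")
      case False
      then have "A = {}" "B = {}" using lh by (fastforce simp: A_def B_def)+
      then have "S \<subseteq> {lo, hi}" using S by simp
      then have "card S \<le> card {lo, hi}" by (intro card_mono) auto
      also have "\<dots> \<le> 2" by (simp add: card_insert_if)
      finally show ?thesis by simp
    next
      case True
      then have AB: "lo \<in> A" "hi \<in> B" "finite A" "finite B"
        using lh fin by (auto simp: A_def B_def)
      \<comment> \<open>\<open>S\<close> lies on the stretch from \<open>\<beta>\<close> up to
        \<open>hi\<close> and on from \<open>lo\<close> to \<open>\<alpha>\<close>. Either this fits
        into one window, or \<open>S\<close> consists of these four extreme vertices at
        most.\<close>
      define \<alpha> \<beta> where "\<alpha> = Max A" and "\<beta> = Min B"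
      have ab: "\<alpha> \<in> A" "\<beta> \<in> B" "\<And>y. y \<in> A \<Longrightarrow> y \<le> \<alpha>" "\<And>y. y \<in> B \<Longrightarrow> \<beta> \<le> y"
        using AB by (auto simp: \<alpha>_def \<beta>_def intro: Max_in Min_in)
      then have abS: "\<alpha> \<in> S" "\<beta> \<in> S" "\<alpha> + n \<le> hi + D" "lo + n \<le> \<beta> + D"
        by (auto simp: A_def B_def)
      have SAB: "S \<subseteq> A \<union> B" using S AB by auto
      have hn: "hi < n" using ltn lh(2) by blast
      have "\<alpha> < \<beta>" using abS hn assms(2) by linarith
      show ?thesis
      proof (cases "\<alpha> + n \<le> \<beta> + D")
        case True
        have "S \<subseteq> {lo..\<alpha>} \<union> {\<beta>..hi}"
        proof
          fix y assume "y \<in> S"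
          moreover from this have "y \<in> A \<or> y \<in> B" using SAB by blast
          ultimately show "y \<in> {lo..\<alpha>} \<union> {\<beta>..hi}"
            using ab(3,4)[of y] lh(3,4)[of y] by auto
        qed
        then have "card S \<le> card ({lo..\<alpha>} \<union> {\<beta>..hi})" by (intro card_mono) auto
        also have "\<dots> \<le> card {lo..\<alpha>} + card {\<beta>..hi}" by (rule card_Un_le)
        also have "\<dots> \<le> D + 1"
          using True hn lh(3)[OF abS(1)] lh(4)[OF abS(2)] by simp
        finally show ?thesis by simp
      next
        case near: False
        \<comment> \<open>In both triples \<open>near\<close> removes one alternative and
          \<open>2 * D \<le> n\<close> another, which leaves the direct distance.\<close>
        have left: "\<beta> \<le> lo + D" if "lo < \<alpha>"
          using triple[OF lh(1) abS(1,2) that \<open>\<alpha> < \<beta>\<close>] near abS(3,4) hn assms(2) by linarith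
        have right: "hi \<le> \<alpha> + D" if "\<beta> < hi"
          using triple[OF abS(1,2) lh(2) \<open>\<alpha> < \<beta>\<close> that] near abS(3,4) hn assms(2) by linarith
        \<comment> \<open>A further vertex \<open>y\<close> of \<open>A\<close> would make both
          \<open>left\<close> and \<open>right\<close> applicable, and then no window contains
          \<open>y\<close>, \<open>\<beta>\<close> and \<open>hi\<close>. The argument for
          \<open>B\<close> is the mirror image.\<close>
        have "A \<subseteq> {lo, \<alpha>}"
        proof (rule ccontr)
          assume "\<not> ?thesis"
          then obtain y where y: "y \<in> A" "y \<noteq> lo" "y \<noteq> \<alpha>" by blast
          then have "y \<in> S" "lo < y" "y < \<alpha>"
            using lh(3) ab(3) by (auto simp: A_def order_less_le)
          moreover have "\<beta> < hi" using left calculation far lh(4)[OF abS(2)] by linarith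
          ultimately show False
            using triple[of y \<beta> hi] left right abS lh(2) \<open>\<alpha> < \<beta>\<close> assms(2) hn by auto
        qed
        moreover have "B \<subseteq> {\<beta>, hi}"
        proof (rule ccontr)
          assume "\<not> ?thesis"
          then obtain y where y: "y \<in> B" "y \<noteq> \<beta>" "y \<noteq> hi" by blast
          then have "y \<in> S" "\<beta> < y" "y < hi"
            using lh(4) ab(4) by (auto simp: B_def order_less_le)
          moreover have "lo < \<alpha>" using right calculation far lh(3)[OF abS(1)] by linarith
          ultimately show False
            using triple[of lo \<alpha> y] left right abS lh(1) \<open>\<alpha> < \<beta>\<close> assms(2) hn by auto
        qed
        ultimately have "S \<subseteq> {lo, \<alpha>, \<beta>, hi}" using SAB by auto
        then have "card S \<le> card {lo, \<alpha>, \<beta>, hi}" by (intro card_mono) auto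
        also have "\<dots> \<le> 4" by (simp add: card_insert_if)
        finally show ?thesis by simp
      qed
    qed
  qed
qed simp

text \<open>Lifts at distance at most \<open>D \<le> n / 2\<close> have turn numbers that agree, or
  else the smaller residue is exactly one turn ahead. For \<open>x < y < z\<close> this leaves three
  patterns of turn numbers, one for each alternative.\<close>

lemma window_triple:
  fixes x y z n D :: nat and i j k a :: int
  assumes "x < y" "y < z" "z < n" "2 * D \<le> n"
    and "int x = i mod int n" "int y = j mod int n" "int z = k mod int n"
    and "{i, j, k} \<subseteq> {a..a + int D}"
  shows "z \<le> x + D \<or> x + n \<le> y + D \<or> y + n \<le> z + D"
proof -
  have *: "s = t \<or> s = t + 1"
    if "v < int n" "0 \<le> u" "u < v" "\<bar>(u + int n * s) - (v + int n * t)\<bar> \<le> int D" for u v s t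
  proof (rule ccontr)
    assume "\<not> ?thesis"
    then consider "s \<le> t - 1" | "s \<ge> t + 2" by linarith
    then show False
    proof cases
      case 1
      then have "int n * s \<le> int n * (t - 1)" by (intro mult_left_mono) auto
      then show ?thesis using that assms by (simp add: right_diff_distrib)
    next
      case 2
      then have "int n * (t + 2) \<le> int n * s" by (intro mult_left_mono) auto
      then show ?thesis using that assms by (simp add: distrib_left)
    qed
  qed
  define p q r where "p = i div int n" "q = j div int n" "r = k div int n"
  have i: "i = int x + int n * p" and j: "j = int y + int n * q" and k: "k = int z + int n * r"
    using assms(5-7) by (simp_all add: p_q_r_def)
  have near: "\<bar>i - j\<bar> \<le> int D" "\<bar>i - k\<bar> \<le> int D" "\<bar>j - k\<bar> \<le> int D"
    using assms(8) by auto
  have "p = q \<or> p = q + 1"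
    by (rule *[of "int y" "int x"]) (use assms(1-4) near[unfolded i j k] in \<open>linarith+\<close>)
  moreover have "p = r \<or> p = r + 1"
    by (rule *[of "int z" "int x"]) (use assms(1-4) near[unfolded i j k] in \<open>linarith+\<close>)
  moreover have "q = r \<or> q = r + 1"
    by (rule *[of "int z" "int y"]) (use assms(1-4) near[unfolded i j k] in \<open>linarith+\<close>)
  ultimately consider "p = r" "q = r" | "p = r + 1" "q = r" | "p = r + 1" "q = r + 1" by linarith
  then show ?thesis
  proof cases
    case 1
    then show ?thesis using near[unfolded i j k] by simp linarith
  next
    case 2
    then show ?thesis using near[unfolded i j k] by (simp add: distrib_left) linarith
  next
    case 3
    then show ?thesis using near[unfolded i j k] by (simp add: distrib_left) linarith
  qed
qed

section \<open>Arithmetic of the criterion\<close>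

text \<open>For odd \<open>D\<close>, \<open>D + 1\<close> is twice \<open>m = D div 2 + 1\<close>,
  so \<open>2 * n div (D + 1)\<close> is \<open>n div m\<close> and the criterion becomes
  divisibility by \<open>m\<close>.\<close>

lemma le_mult_div_iff_dvd:
  fixes n m :: nat
  shows "n \<le> m * (n div m) \<longleftrightarrow> m dvd n"
proof -
  have "n \<le> m * (n div m) \<longleftrightarrow> m * (n div m) = n"
    using times_div_less_eq_dividend[of m n] by linarith
  also have "\<dots> \<longleftrightarrow> m dvd n"
    by (metis dvd_mult_div_cancel dvd_triv_left)
  finally show ?thesis .
qed

lemma bound_by_quotient_iff:
  fixes n :: nat
  assumes "n \<ge> 3"
  shows
    "n \<le> (min 2 (n div 2) div 2 + 1) * (2 * n div (min 2 (n div 2) + 1))"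
    "n \<le> (min 3 (n div 2) div 2 + 1) * (2 * n div (min 3 (n div 2) + 1)) \<longleftrightarrow> n < 7 \<or> (n \<ge> 7 \<and> 2 dvd n)"
    "n \<le> (min 4 (n div 2) div 2 + 1) * (2 * n div (min 4 (n div 2) + 1)) \<longleftrightarrow> n \<noteq> 7"
    "n \<le> (min 5 (n div 2) div 2 + 1) * (2 * n div (min 5 (n div 2) + 1)) \<longleftrightarrow>
       (n < 10 \<and> n \<noteq> 7) \<or> (n \<ge> 10 \<and> 3 dvd n)"
    "n \<le> (min 6 (n div 2) div 2 + 1) * (2 * n div (min 6 (n div 2) + 1)) \<longleftrightarrow> n \<notin> {7, 10, 11, 13, 17}"
    "n \<le> (min 7 (n div 2) div 2 + 1) * (2 * n div (min 7 (n div 2) + 1)) \<longleftrightarrow>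
       (n < 14 \<and> n \<notin> {7, 10, 11, 13}) \<or> (n \<ge> 14 \<and> 4 dvd n)"
    "n \<le> (min 8 (n div 2) div 2 + 1) * (2 * n div (min 8 (n div 2) + 1)) \<longleftrightarrow>
       n \<notin> {7, 10, 11, 13, 14, 15, 16, 17, 21, 22, 26, 31}"
    "n \<le> (min 9 (n div 2) div 2 + 1) * (2 * n div (min 9 (n div 2) + 1)) \<longleftrightarrow>
       (n < 18 \<and> n \<notin> {7, 10, 11, 13, 14, 15, 16, 17}) \<or> (n \<ge> 18 \<and> 5 dvd n)"
proof -
  \<comment> \<open>Small \<open>n\<close> are checked one by one. The threshold 32 follows the
    largest exception, 31 for \<open>d = 8\<close>; from there on \<open>n div 2 \<ge> 9\<close>,
    and every minimum is just \<open>d\<close>.\<close>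
  have "n \<in> {3, 4, 5, 6, 7, 8, 9, 10, 11, 12, 13, 14, 15, 16, 17,
    18, 19, 20, 21, 22, 23, 24, 25, 26, 27, 28, 29, 30, 31}" if "n < 32"
    using assms that by (auto simp: less_Suc_eq numeral_eq_Suc)
  moreover have "n div 2 \<ge> 9" if "n \<ge> 32" using that by simp
  ultimately consider "n \<in> {3, 4, 5, 6, 7, 8, 9, 10, 11, 12, 13, 14, 15, 16, 17,
    18, 19, 20, 21, 22, 23, 24, 25, 26, 27, 28, 29, 30, 31}"
    | "n \<ge> 32" "n div 2 \<ge> 9"
    using not_less by blast
  note cases = this
  \<comment> \<open>The criteria for \<open>d = 2, 4, 6, 8\<close>; for even \<open>d\<close> the
    loss from rounding is made up once \<open>n\<close> is large.\<close>
  have large: "n \<le> 2 * (2 * n div 3)" "n \<le> 3 * (2 * n div 5)" "n \<le> 4 * (2 * n div 7)"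
    "n \<le> 5 * (2 * n div 9)" if "n \<ge> 32"
    using that by linarith+
  show "n \<le> (min 2 (n div 2) div 2 + 1) * (2 * n div (min 2 (n div 2) + 1))"
    using cases
  proof cases
    case 1
    then show ?thesis by (elim insertE emptyE; simp flip: numeral_2_eq_2)
  next
    case 2
    then show ?thesis by (auto simp: min_absorb1 large)
  qed
  show "n \<le> (min 3 (n div 2) div 2 + 1) * (2 * n div (min 3 (n div 2) + 1)) \<longleftrightarrow> n < 7 \<or> (n \<ge> 7 \<and> 2 dvd n)"
    using cases
  proof cases
    case 1
    then show ?thesis by (elim insertE emptyE; simp flip: numeral_2_eq_2)
  next
    case 2
    have eq: "(min 3 (n div 2) div 2 + 1) * (2 * n div (min 3 (n div 2) + 1)) = 2 * (n div 2)"
      using 2 by (simp add: min_absorb1)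
    have "\<not> n < 7" "n \<ge> 7" using 2(1) by simp_all
    then show ?thesis unfolding eq le_mult_div_iff_dvd by blast
  qed
  show "n \<le> (min 4 (n div 2) div 2 + 1) * (2 * n div (min 4 (n div 2) + 1)) \<longleftrightarrow> n \<noteq> 7"
    using cases
  proof cases
    case 1
    then show ?thesis by (elim insertE emptyE; simp flip: numeral_2_eq_2)
  next
    case 2
    then show ?thesis by (auto simp: min_absorb1 large)
  qed
  show "n \<le> (min 5 (n div 2) div 2 + 1) * (2 * n div (min 5 (n div 2) + 1)) \<longleftrightarrow>
       (n < 10 \<and> n \<noteq> 7) \<or> (n \<ge> 10 \<and> 3 dvd n)"
    using cases
  proof cases
    case 1
    then show ?thesis by (elim insertE emptyE; simp flip: numeral_2_eq_2)
  next
    case 2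
    then show ?thesis by (simp add: min_absorb1 le_mult_div_iff_dvd)
  qed
  show "n \<le> (min 6 (n div 2) div 2 + 1) * (2 * n div (min 6 (n div 2) + 1)) \<longleftrightarrow> n \<notin> {7, 10, 11, 13, 17}"
    using cases
  proof cases
    case 1
    then show ?thesis by (elim insertE emptyE; simp flip: numeral_2_eq_2)
  next
    case 2
    then show ?thesis by (auto simp: min_absorb1 large)
  qed
  show "n \<le> (min 7 (n div 2) div 2 + 1) * (2 * n div (min 7 (n div 2) + 1)) \<longleftrightarrow>
       (n < 14 \<and> n \<notin> {7, 10, 11, 13}) \<or> (n \<ge> 14 \<and> 4 dvd n)"
    using cases
  proof cases
    case 1
    then show ?thesis by (elim insertE emptyE; simp flip: numeral_2_eq_2)
  next
    case 2
    then show ?thesis by (simp add: min_absorb1 le_mult_div_iff_dvd)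
  qed
  show "n \<le> (min 8 (n div 2) div 2 + 1) * (2 * n div (min 8 (n div 2) + 1)) \<longleftrightarrow>
       n \<notin> {7, 10, 11, 13, 14, 15, 16, 17, 21, 22, 26, 31}"
    using cases
  proof cases
    case 1
    then show ?thesis by (elim insertE emptyE; simp flip: numeral_2_eq_2)
  next
    case 2
    then show ?thesis by (auto simp: min_absorb1 large)
  qed
  show "n \<le> (min 9 (n div 2) div 2 + 1) * (2 * n div (min 9 (n div 2) + 1)) \<longleftrightarrow>
       (n < 18 \<and> n \<notin> {7, 10, 11, 13, 14, 15, 16, 17}) \<or> (n \<ge> 18 \<and> 5 dvd n)"
    using cases
  proof cases
    case 1
    then show ?thesis by (elim insertE emptyE; simp flip: numeral_2_eq_2)
  next
    case 2
    then show ?thesis by (simp add: min_absorb1 le_mult_div_iff_dvd)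
  qed
qed

section \<open>Cliques and induced subgraphs of the cycle, and the criterion\<close>

text \<open>Any three clique vertices lie on a shortest path of length at most \<open>D\<close>,
  whose lift places them in a common window.\<close>

lemma cycle_graph_clique_card_le:
  assumes "n \<ge> 3" "kd_clique 3 d (cycle_graph n) S"
  shows "card S \<le> max 4 (min d (n div 2) + 1)"
proof (rule card_pairwise_windows_le)
  show "S \<subseteq> {0..<n}" using assms(2) by (simp add: kd_clique_def cycle_graph_simps)
  show "2 * min d (n div 2) \<le> n" by simp
  fix x y z assume S: "x \<in> S" "y \<in> S" "z \<in> S" and xyz: "x < y" "y < z"
  have "card {x, y, z} = 3" using xyz by simp
  then obtain u p v where p: "shortest_path (cycle_graph n) u p v" "length p \<le> d"
    "{x, y, z} \<subseteq> set (pre_digraph.awalk_verts (cycle_graph n) u p)"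
    using assms(2) S unfolding kd_clique_def
    by (metis empty_subsetI finite.emptyI finite_insert insert_subset)
  have "pre_digraph.awalk (cycle_graph n) u p v"
    using p(1) by (simp add: shortest_path_iff[OF wf_digraph_cycle_graph[OF assms(1)]] pre_digraph.apath_def)
  then obtain a where a: "\<forall>x\<in>set (pre_digraph.awalk_verts (cycle_graph n) u p).
      \<exists>i\<in>{a..a + int (length p)}. int x = i mod int n"
    using cycle_graph_awalk_window[OF assms(1)] by blast
  then obtain i j k where "int x = i mod int n" "int y = j mod int n" "int z = k mod int n"
    "{i, j, k} \<subseteq> {a..a + int (length p)}"
    using p(3) by (metis (no_types, lifting) empty_subsetI insert_subset)
  moreover have "length p \<le> min d (n div 2)"
    using cycle_graph_shortest_path_length[OF assms(1) p(1)] p(2) by simp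
  moreover have "z < n" using S(3) \<open>S \<subseteq> {0..<n}\<close> by auto
  ultimately show "z \<le> x + min d (n div 2) \<or> x + n \<le> y + min d (n div 2) \<or> y + n \<le> z + min d (n div 2)"
    using xyz by (intro window_triple[of x y z n _ i j k a]) auto
qed

lemma chromatic_eq_ceil_clique_proper_induced_subgraph:
  assumes "n \<ge> 3" and H: "induced_subgraph H (cycle_graph n)"
    and "verts H \<noteq> {}" "verts H \<noteq> {0..<n}"
  shows "kd_chromatic_number 3 d H = ceil_divide_enat (kd_clique_number 3 d H) 2"
proof -
  have wf: "wf_digraph H" and sub: "verts H \<subseteq> {0..<n}"
    and th: "tail H = fst" "head H = snd"
    and arcs: "arcs H \<subseteq> {e. fst e \<in> verts H \<and> snd e \<in> verts H \<and>
      (snd e = (fst e + 1) mod n \<or> fst e = (snd e + 1) mod n)}"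
    using H by (auto simp: induced_subgraph_def subgraph_def compatible_def cycle_graph_simps)
  have "\<not> {0..<n} \<subseteq> verts H" using sub assms(4) by blast
  then obtain w where "w \<in> {0..<n}" "w \<notin> verts H" by blast
  then have w: "w < n" "w \<notin> verts H" by simp_all
  \<comment> \<open>Cutting the cycle at the missing vertex \<open>w\<close> lays the rest out on a
    line: \<open>pos x\<close> counts the steps from \<open>w\<close> upwards to \<open>x\<close>,
    passing from \<open>n - 1\<close> to 0 if \<open>x < w\<close>.\<close>
  define pos where "pos x = (if w \<le> x then int x - int w else int x + int n - int w)" for x
  obtain u p v where longest: "shortest_path H u p v" "length p \<le> d"
    "\<And>u' p' v'. shortest_path H u' p' v' \<Longrightarrow> length p' \<le> d \<Longrightarrow> length p' \<le> length p"
    by (rule ex_longest_shortest_path[OF wf assms(3), of d]) blast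
  let ?m = "length p div 2 + 1"
  show ?thesis
  \<comment> \<open>With \<open>q = 1\<close> the colour is \<open>pos x\<close> modulo
    \<open>?m\<close>, so a third vertex of a colour comes at least
    \<open>2 * ?m \<ge> length p + 1\<close> after the first.\<close>
  proof (rule chromatic_eq_ceil_clique_of_lift[where R = "\<lambda>x i. x \<in> verts H \<and> i = pos x"
        and q = 1 and m = ?m and f = "\<lambda>x. (pos x * int 1) mod int ?m div int 1"])
    show "finite (verts H)" using sub finite_subset by blast
    show "(tail H e \<in> verts H \<and> i - 1 = pos (tail H e)) \<or> (tail H e \<in> verts H \<and> i + 1 = pos (tail H e))"
      if e: "e \<in> arcs H" and i: "head H e \<in> verts H \<and> i = pos (head H e)" for e i
    proof -
      obtain x y where xy: "e = (x, y)" by fastforce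
      have v: "x \<in> verts H" "y \<in> verts H" and adj: "y = (x + 1) mod n \<or> x = (y + 1) mod n"
        using arcs e xy by auto
      then have "x < n" "y < n" "x \<noteq> w" "y \<noteq> w" using sub w by auto
      moreover have "(a + 1) mod n = (if a + 1 < n then a + 1 else 0)" if "a < n" for a
        using that by (cases "a + 1 = n") auto
      ultimately have "pos x = pos y - 1 \<or> pos x = pos y + 1"
        using adj w(1) unfolding pos_def by (auto split: if_splits)
      then show ?thesis using i xy th v by auto
    qed
    show "x = y" if "x \<in> verts H \<and> i = pos x" "y \<in> verts H \<and> i = pos y" for x y i
    proof -
      have "x < n" "y < n" using that sub by auto
      then show ?thesis using that w(1) by (auto simp: pos_def split: if_splits)
    qed
    show "1 * (length p + 1) \<le> 2 * ?m" by simp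
  qed (use wf longest in auto)
qed

lemma induced_subgraph_all_verts:
  assumes "induced_subgraph H G" "verts H = verts G"
  shows "H = G"
proof (rule pre_digraph.equality)
  have "wf_digraph G" using assms(1) by (simp add: induced_subgraph_def subgraph_def)
  then show "arcs H = arcs G"
    using assms by (auto simp: induced_subgraph_def wf_digraph_def)
qed (use assms in \<open>auto simp: induced_subgraph_def subgraph_def compatible_def\<close>)

theorem kd_perfect_3_cycle_graph_iff:
  fixes n d :: nat
  assumes "n \<ge> 3" "d \<ge> 2"
  defines "D \<equiv> min d (n div 2)"
  shows "kd_perfect 3 d (cycle_graph n) \<longleftrightarrow> n \<le> (D div 2 + 1) * (2 * n div (D + 1))"
proof -
  note wf = wf_digraph_cycle_graph[OF assms(1)]
  have "D < n" "D \<le> d" "D \<le> n div 2" "D \<ge> 1" using assms by auto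
  have self: "induced_subgraph (cycle_graph n) (cycle_graph n)"
    using wf by (auto simp: induced_subgraph_def subgraph_def compatible_def wf_digraph_def)
  \<comment> \<open>Proper induced subgraphs always satisfy the equation, so only the cycle itself
    has to be examined.\<close>
  have "kd_perfect 3 d (cycle_graph n) \<longleftrightarrow>
      kd_chromatic_number 3 d (cycle_graph n) = ceil_divide_enat (kd_clique_number 3 d (cycle_graph n)) 2"
    (is "_ \<longleftrightarrow> ?eq")
  proof
    assume "kd_perfect 3 d (cycle_graph n)"
    then show ?eq using self assms(1) unfolding kd_perfect_def by (auto simp: cycle_graph_simps)
  next
    assume ?eq
    show "kd_perfect 3 d (cycle_graph n)"
      unfolding kd_perfect_def
    proof (intro allI impI)
      fix H assume H: "induced_subgraph H (cycle_graph n) \<and> verts H \<noteq> {}"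
      show "kd_chromatic_number 3 d H = ceil_divide_enat (kd_clique_number 3 d H) (3 - 1)"
      proof (cases "verts H = {0..<n}")
        case True
        then have "H = cycle_graph n"
          using H by (intro induced_subgraph_all_verts) (auto simp: cycle_graph_simps)
        then show ?thesis using \<open>?eq\<close> by simp
      next
        case False
        then show ?thesis
          using chromatic_eq_ceil_clique_proper_induced_subgraph[OF assms(1)] H by simp
      qed
    qed
  qed
  also have "?eq \<longleftrightarrow> n \<le> (D div 2 + 1) * (2 * n div (D + 1))"
  proof
    assume le: "n \<le> (D div 2 + 1) * (2 * n div (D + 1))"
    let ?q = "2 * n div (D + 1)"
    obtain p where p: "shortest_path (cycle_graph n) 0 p ((0 + D) mod n)" "length p = D"
      using cycle_graph_shortest_path_window[OF assms(1) \<open>D \<le> n div 2\<close>, of 0] assms(1) by auto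
    show ?eq
    proof (rule chromatic_eq_ceil_clique_of_lift[where R = "\<lambda>x i. int x = i mod int n"
          and q = ?q and m = n and f = "\<lambda>x. (int x * int ?q) mod int n div int ?q"])
      show "\<exists>i. int x = i mod int n" if "x \<in> verts (cycle_graph n)" for x
        using that by (intro exI[of _ "int x"]) (simp add: cycle_graph_simps)
      show "int (tail (cycle_graph n) e) = (i - 1) mod int n \<or>
          int (tail (cycle_graph n) e) = (i + 1) mod int n"
        if "e \<in> arcs (cycle_graph n)" "int (head (cycle_graph n) e) = i mod int n" for e i
        using that by (rule cycle_graph_arc_lift)
      \<comment> \<open>The colour depends on the residue of the lift only, which makes it well
        defined around the cycle.\<close>
      show "int x * int ?q mod int n div int ?q = i * int ?q mod int n div int ?q"
        if "int x = i mod int n" for x i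
        unfolding that by (simp add: mod_mult_left_eq)
      show "?q > 0" using \<open>D < n\<close> by (simp add: div_greater_zero_iff)
      show "n \<le> (length p div 2 + 1) * ?q" using le p by simp
      show "?q * (length p + 1) \<le> 2 * n" unfolding p(2) by (rule div_times_less_eq_dividend)
      show "length p' \<le> length p"
        if "shortest_path (cycle_graph n) u' p' v'" "length p' \<le> d" for u' p' v'
        using cycle_graph_shortest_path_length[OF assms(1) that(1)] that(2) p(2) by (simp add: D_def)
    qed (use wf p \<open>D \<le> d\<close> assms(1) in \<open>auto simp: cycle_graph_simps\<close>)
  next
    assume ?eq
    show "n \<le> (D div 2 + 1) * (2 * n div (D + 1))"
    \<comment> \<open>Here the bound 4 on cliques exceeds \<open>2 * (D div 2 + 1) = 2\<close>; but
      only the triangle has \<open>D = 1\<close>, and it satisfies the inequality.\<close>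
    proof (cases "D = 1")
      case True
      then have "n = 3" using assms by (auto simp: D_def min_def split: if_splits)
      then show ?thesis using True by (simp flip: numeral_2_eq_2)
    next
      case False
      let ?c = "D div 2 + 1"
      have "kd_clique_number 3 d (cycle_graph n) \<le> enat (2 * ?c)"
        unfolding kd_clique_number_def
      proof (rule SUP_least)
        fix S assume "S \<in> {S. kd_clique 3 d (cycle_graph n) S}"
        then have S: "kd_clique 3 d (cycle_graph n) S" by simp
        then have "finite S"
          by (auto simp: kd_clique_def cycle_graph_simps intro: finite_subset)
        moreover have "card S \<le> 2 * ?c"
        proof -
          have "D \<ge> 2" using False \<open>D \<ge> 1\<close> by simp
          then have "1 \<le> D div 2" by presburger
          have "card S \<le> max 4 (D + 1)"
            using cycle_graph_clique_card_le[OF assms(1) S] by (simp add: D_def)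
          also have "\<dots> \<le> 2 * ?c" using \<open>1 \<le> D div 2\<close> by simp
          finally show ?thesis .
        qed
        ultimately show "(if finite S then enat (card S) else \<infinity>) \<le> enat (2 * ?c)" by simp
      qed
      from colouring_of_chromatic_eq[OF \<open>?eq\<close> this]
      obtain c f where c: "c \<le> ?c" and f: "f ` verts (cycle_graph n) \<subseteq> {1..c}"
        "\<forall>i\<in>{1..c}. kd_independent 3 d (cycle_graph n) {x \<in> verts (cycle_graph n). f x = i}"
        by blast
      \<comment> \<open>Every window of \<open>D + 1\<close> vertices is a shortest path of length
        \<open>D \<le> d\<close>, so it meets a colour class at most twice; double counting then
        bounds each class.\<close>
      have "card {0..<n} \<le> c * (2 * n div (D + 1))"
      proof (rule card_le_mult_classes)
        show "f ` {0..<n} \<subseteq> {1..c}" using f(1) by (simp add: cycle_graph_simps)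
        fix i assume "i \<in> {1..c}"
        let ?I = "{x \<in> {0..<n}. f x = i}"
        have I: "kd_independent 3 d (cycle_graph n) ?I"
          using f(2) \<open>i \<in> {1..c}\<close> by (simp add: cycle_graph_simps)
        have "card (?I \<inter> (\<lambda>i. (a + i) mod n) ` {0..D}) \<le> 2" if a: "a < n" for a
        proof -
          obtain p where "shortest_path (cycle_graph n) a p ((a + D) mod n)" "length p = D"
            "set (pre_digraph.awalk_verts (cycle_graph n) a p) = (\<lambda>i. (a + i) mod n) ` {0..D}"
            using cycle_graph_shortest_path_window[OF assms(1) \<open>D \<le> n div 2\<close> a] by blast
          then have "card (?I \<inter> (\<lambda>i. (a + i) mod n) ` {0..D}) < 3"
            using I \<open>D \<le> d\<close> unfolding kd_independent_def by metis
          then show ?thesis by simp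
        qed
        then have "card ?I * (D + 1) \<le> 2 * n"
          using \<open>D < n\<close> by (intro card_le_windows_nat) auto
        then show "card ?I \<le> 2 * n div (D + 1)" by (simp add: less_eq_div_iff_mult_less_eq)
      qed simp
      also have "\<dots> \<le> ?c * (2 * n div (D + 1))" using c by (intro mult_right_mono) auto
      finally show ?thesis by simp
    qed
  qed
  finally show ?thesis .
qed

theorem corollary5p14:
  fixes n :: nat
  assumes "n \<ge> 3"
  shows "kd_perfect 3 2 (cycle_graph n) \<and>
         (kd_perfect 3 3 (cycle_graph n) \<longleftrightarrow> n < 7 \<or> (n \<ge> 7 \<and> 2 dvd n)) \<and>
         (kd_perfect 3 4 (cycle_graph n) \<longleftrightarrow> n \<noteq> 7) \<and>
         (kd_perfect 3 5 (cycle_graph n) \<longleftrightarrow> (n < 10 \<and> n \<noteq> 7) \<or> (n \<ge> 10 \<and> 3 dvd n)) \<and>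
         (kd_perfect 3 6 (cycle_graph n) \<longleftrightarrow> n \<notin> {7, 10, 11, 13, 17}) \<and>
         (kd_perfect 3 7 (cycle_graph n) \<longleftrightarrow> (n < 14 \<and> n \<notin> {7, 10, 11, 13}) \<or> (n \<ge> 14 \<and> 4 dvd n)) \<and>
         (kd_perfect 3 8 (cycle_graph n) \<longleftrightarrow> n \<notin> {7, 10, 11, 13, 14, 15, 16, 17, 21, 22, 26, 31}) \<and>
         (kd_perfect 3 9 (cycle_graph n) \<longleftrightarrow> (n < 18 \<and> n \<notin> {7, 10, 11, 13, 14, 15, 16, 17}) \<or> (n \<ge> 18 \<and> 5 dvd n))"
proof -
  have "kd_perfect 3 d (cycle_graph n) \<longleftrightarrow>
      n \<le> (min d (n div 2) div 2 + 1) * (2 * n div (min d (n div 2) + 1))" if "2 \<le> d" for d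
    using kd_perfect_3_cycle_graph_iff[OF assms that] .
  note iff = this
  show ?thesis
    \<comment> \<open>The criterion turns each conjunct into one of the facts of
      \<open>bound_by_quotient_iff\<close>; \<open>simp\<close> settles the side condition
      \<open>2 \<le> d\<close>.\<close>
    by (intro conjI; subst iff; (rule bound_by_quotient_iff[OF assms] | simp))
qed

end
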